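(* Let $u,\ell,m\ge 1$ be integers with $u\ge \ell + 2\log(\ell m)$, and let $n\coloneqq 2^\ell$. Let $\mathcal{H}$ be the set of all surjective linear maps $\mathbb{F}_2^u\to\mathbb{F}_2^\ell$, and let $S\subset \mathbb{F}_2^u$ be a subset of size $m$. Then for any real $r\ge 6$, if $h$ is drawn uniformly at random from $\mathcal{H}$, \[\Pr_{h\sim \mathcal{H}}\left[M(S,h)\ge r\cdot \textsc{opt}(m,n)\right]\le \frac{48}{(r-2)^2}.\]
   Context: $\log$ denotes the base-2 logarithm and $\ln$ the natural logarithm. For a map $h:A\to B$ and $S\subset A$, $M(S,h)\coloneqq \max_{y\in B}|h^{-1}(y)\cap S|$. For positive integers $m,n$, \[\textsc{opt}(m,n) = \begin{cases} \dfrac{\log n}{\log\left(\frac{n\ln n}{m}\right)} & m\le \frac{1}{2} n\log n, \\[2mm] \dfrac{m}{n} & m > \frac{1}{2}n\log n. \end{cases}\] *)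

theory Defs
  imports "HOL-Probability.Probability" "HOL-Library.Z2"
begin

definition max_load :: "'a set \<Rightarrow> ('a \<Rightarrow> 'b) \<Rightarrow> nat" where
  "max_load S h = Max (range (\<lambda>y. card (h -` {y} \<inter> S)))"

definition opt :: "nat \<Rightarrow> nat \<Rightarrow> real" where
  "opt m n =
    (if real m \<le> 1 / 2 * real n * log 2 (real n)
     then log 2 (real n) / log 2 (real n * ln (real n) / real m)
     else real m / real n)"

text \<open>The field with two elements is the type \<^typ>\<open>bit\<close>; its \<open>u\<close>-dimensional coordinate space
  is \<open>bit ^ 'u\<close> with \<open>CARD('u) = u\<close>.\<close>

definition surj_linear_maps :: "(bit ^ 'u \<Rightarrow> bit ^ 'l) set" where
  "surj_linear_maps = {h. Vector_Spaces.linear (*s) (*s) h \<and> surj h}"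

end

theory Submission
  imports Defs
begin

text \<open>
  Build the kernel \<open>W\<close> of \<open>h\<close> by adjoining one random vector at a time and follow the potential
  \<open>\<Phi>(W) = E\<^sub>x exp (c |S \<inter> (x + W)|)\<close>. Adjoining \<open>v\<close> turns the exponential \<open>g\<close> into \<open>g(x) g(x + v)\<close>, so
  on average \<open>\<Phi>\<close> is at most squared, and by concavity \<open>ln \<Phi>\<close> at most doubles. With \<open>a = m / n\<close> this
  gives \<open>E ln \<Phi>(ker h) \<le> a (exp c - 1)\<close>. On the other hand \<open>ln \<Phi> \<ge> c a\<close> always (Jensen), and a
  bin of load \<open>t\<close> forces \<open>ln \<Phi> \<ge> c t - ln n\<close>. Markov's inequality for \<open>ln \<Phi> - c a\<close> bounds the probability
  of such a bin by \<open>a (exp c - 1 - c) / (c (t - a) - ln n)\<close>; the numerator is quadratic in \<open>c\<close>, and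
  \<open>c\<close> of order \<open>1 / r\<close> yields the tail \<open>O(1 / r\<^sup>2)\<close>.
\<close>

section \<open>The potential of a subgroup\<close>

lemma mem_translate_iff: "y \<in> (+) v ` W \<longleftrightarrow> y - (v :: 'a::ab_group_add) \<in> W"
proof
  assume "y - v \<in> W"
  then show "y \<in> (+) v ` W" by (intro image_eqI[of _ _ "y - v"]) simp_all
qed auto

text \<open>For \<open>W\<close> the kernel of \<open>h\<close> this is the load of the bin
  \<open>h x\<close>. Indexing bins by points of the domain makes sense for subgroups of every size,
  so \<open>W\<close> can grow from \<open>{0}\<close> to a kernel.\<close>

definition coset_load :: "'a::{finite,ab_group_add} set \<Rightarrow> 'a set \<Rightarrow> 'a \<Rightarrow> nat" where
  "coset_load S W x = card {s \<in> S. s - x \<in> W}"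

text \<open>The moment generating function, at \<open>c\<close>, of the load of the coset through a
  uniformly random point.\<close>

definition coset_mgf :: "real \<Rightarrow> 'a::{finite,ab_group_add} set \<Rightarrow> 'a set \<Rightarrow> real" where
  "coset_mgf c S W = (\<Sum>x\<in>UNIV. exp (c * real (coset_load S W x))) / real CARD('a)"

lemma coset_load_add:
  fixes W :: "'a::{finite,ab_group_add} set"
  assumes add: "\<And>v w. v \<in> W \<Longrightarrow> w \<in> W \<Longrightarrow> v + w \<in> W"
    and minus: "\<And>w. w \<in> W \<Longrightarrow> - w \<in> W" and w: "w \<in> W"
  shows "coset_load S W (x + w) = coset_load S W x"
proof -
  have "s - (x + w) \<in> W \<longleftrightarrow> s - x \<in> W" for s
    using add[of "s - (x + w)" w] add[of "s - x" "- w"] minus[OF w] w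
    by (auto simp: algebra_simps)
  then show ?thesis by (simp add: coset_load_def)
qed

lemma coset_mgf_pos: "coset_mgf c S W > 0"
  unfolding coset_mgf_def by (intro divide_pos_pos sum_pos) auto

text \<open>Double counting of the pairs \<open>s\<close>, \<open>x\<close> with
  \<open>s - x\<close> in \<open>W\<close>: each \<open>s\<close> is paired with exactly
  \<open>card W\<close> points.\<close>

lemma sum_coset_load:
  fixes S W :: "'a::{finite,ab_group_add} set"
  shows "(\<Sum>x\<in>UNIV. coset_load S W x) = card S * card W"
proof -
  have "card {x. s - x \<in> W} = card W" for s :: 'a
  proof -
    have "{x. s - x \<in> W} = (\<lambda>w. s - w) ` W"
    proof (intro equalityI subsetI)
      fix x assume "x \<in> {x. s - x \<in> W}"
      then show "x \<in> (\<lambda>w. s - w) ` W" by (intro image_eqI[of _ _ "s - x"]) auto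
    qed auto
    then show ?thesis by (simp add: card_image inj_on_def)
  qed
  moreover have "coset_load S W x = (\<Sum>s\<in>S. if s - x \<in> W then 1 else 0)" for x
    by (simp add: coset_load_def sum.If_cases Int_def)
  moreover have "(\<Sum>x\<in>UNIV. \<Sum>s\<in>S. if s - x \<in> W then 1 else 0)
      = (\<Sum>s\<in>S. card {x. s - x \<in> W})"
    by (subst sum.swap) (simp add: sum.If_cases)
  ultimately show ?thesis by simp
qed

text \<open>Jensen's inequality for the exponential, obtained by summing its tangent line at the
  mean load \<open>a\<close>.\<close>

lemma ln_coset_mgf_ge_mean:
  fixes S W :: "'a::{finite,ab_group_add} set"
  shows "c * (real (card S) * real (card W) / real CARD('a)) \<le> ln (coset_mgf c S W)"
proof -
  define N where "N = real CARD('a)"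
  define a where "a = real (card S) * real (card W) / N"
  have N: "N > 0" by (simp add: N_def)
  have le: "exp (c * a) * (1 + c * (real (coset_load S W x) - a)) \<le> exp (c * real (coset_load S W x))" for x
  proof -
    have "exp (c * a) * (1 + c * (real (coset_load S W x) - a))
        \<le> exp (c * a) * exp (c * (real (coset_load S W x) - a))"
      by (intro mult_left_mono exp_ge_add_one_self) auto
    then show ?thesis by (simp add: exp_add[symmetric] algebra_simps)
  qed
  have "(\<Sum>x\<in>UNIV. real (coset_load S W x)) = N * a"
    using sum_coset_load[of S W] N unfolding a_def
    by (simp flip: of_nat_sum)
  then have "(\<Sum>x\<in>(UNIV::'a set). exp (c * a) * (1 + c * (real (coset_load S W x) - a))) = N * exp (c * a)"
    by (simp add: sum_distrib_left[symmetric] sum.distrib sum_subtractf N_def)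
  moreover have "(\<Sum>x\<in>(UNIV::'a set). exp (c * a) * (1 + c * (real (coset_load S W x) - a)))
      \<le> (\<Sum>x\<in>UNIV. exp (c * real (coset_load S W x)))"
    by (intro sum_mono le)
  ultimately have "N * exp (c * a) \<le> (\<Sum>x\<in>UNIV. exp (c * real (coset_load S W x)))"
    by simp
  then have "exp (c * a) \<le> coset_mgf c S W"
    using N by (simp add: coset_mgf_def N_def field_simps)
  then show ?thesis
    using coset_mgf_pos[of c S W] by (simp add: ln_ge_iff a_def N_def)
qed

text \<open>All points of the coset through \<open>x\<close> see the same load, so this coset alone
  contributes its density times the exponential to the average.\<close>

lemma ln_coset_mgf_ge_load:
  fixes S W :: "'a::{finite,ab_group_add} set"
  assumes add: "\<And>v w. v \<in> W \<Longrightarrow> w \<in> W \<Longrightarrow> v + w \<in> W"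
    and minus: "\<And>w. w \<in> W \<Longrightarrow> - w \<in> W" and "W \<noteq> {}"
  shows "c * real (coset_load S W x) - ln (real CARD('a) / real (card W)) \<le> ln (coset_mgf c S W)"
proof -
  have W: "card W > 0" using \<open>W \<noteq> {}\<close> by (simp add: card_gt_0_iff)
  have "real (card W) * exp (c * real (coset_load S W x))
      = (\<Sum>y\<in>(+) x ` W. exp (c * real (coset_load S W y)))"
    by (simp add: sum.reindex coset_load_add[OF add minus])
  also have "\<dots> \<le> (\<Sum>y\<in>UNIV. exp (c * real (coset_load S W y)))"
    by (intro sum_mono2) auto
  finally have "exp (c * real (coset_load S W x)) / (real CARD('a) / real (card W)) \<le> coset_mgf c S W"
    using W by (simp add: coset_mgf_def field_simps)
  then have "ln (exp (c * real (coset_load S W x)) / (real CARD('a) / real (card W))) \<le> ln (coset_mgf c S W)"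
    using W by (intro ln_mono) auto
  then show ?thesis using W \<open>W \<noteq> {}\<close> by (subst (asm) ln_div) auto
qed

text \<open>The starting value: cosets of \<open>{0}\<close> are single points, so the loads form
  the indicator of \<open>S\<close>.\<close>

lemma ln_coset_mgf_zero_le:
  fixes S :: "'a::{finite,ab_group_add} set"
  shows "ln (coset_mgf c S {0}) \<le> real (card S) / real CARD('a) * (exp c - 1)"
proof -
  have "coset_load S {0} x = (if x \<in> S then 1 else 0)" for x
  proof -
    have "{s \<in> S. s - x \<in> {0}} = (if x \<in> S then {x} else {})" by auto
    then show ?thesis by (simp add: coset_load_def)
  qed
  then have "(\<Sum>x\<in>UNIV. exp (c * real (coset_load S {0} x))) = (\<Sum>x\<in>UNIV. 1 + (if x \<in> S then exp c - 1 else 0))"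
    by (intro sum.cong) auto
  also have "\<dots> = real CARD('a) + real (card S) * (exp c - 1)"
    by (simp add: sum.distrib sum.If_cases)
  finally have "coset_mgf c S {0} = 1 + real (card S) / real CARD('a) * (exp c - 1)"
    by (simp add: coset_mgf_def field_simps)
  then show ?thesis
    using ln_le_minus_one[OF coset_mgf_pos[of c S "{0}"]] by simp
qed

text \<open>Averaged over all \<open>v\<close>, the correlation of \<open>g\<close> with its
  translate gives exactly the square of the potential. Leaving out the \<open>v\<close> in
  \<open>W\<close> only lowers the average, since they give the mean of the squares of
  \<open>g\<close>. Concavity of \<open>ln\<close> then passes to logarithms.\<close>

lemma average_ln_coset_mgf_adjoin_le:
  fixes S W :: "'a::{finite,ab_group_add} set"
  assumes two: "\<And>v::'a. v + v = 0"
    and add: "\<And>v w. v \<in> W \<Longrightarrow> w \<in> W \<Longrightarrow> v + w \<in> W"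
  shows "(\<Sum>v\<in>- W. ln (coset_mgf c S (W \<union> (+) v ` W)))
      \<le> real (card (- W)) * (2 * ln (coset_mgf c S W))"
proof -
  define g where "g x = exp (c * real (coset_load S W x))" for x
  define N where "N = real CARD('a)"
  define G where "G = sum g UNIV"
  define Q where "Q = coset_mgf c S W"
  have N: "N > 0" by (simp add: N_def)
  have Q: "Q > 0" by (simp add: Q_def coset_mgf_pos)
  have Q_eq: "Q = G / N" by (simp add: Q_def G_def coset_mgf_def N_def g_def)
  have minus: "- v = v" for v :: 'a
    using two[of v] by (rule minus_unique)
  have inv: "g (x + w) = g x" if "w \<in> W" for x w
    using that by (simp add: g_def coset_load_add add minus)
  \<comment> \<open>As \<open>v\<close> lies outside \<open>W\<close>, the two cosets forming the
    enlarged one are disjoint and their loads add.\<close>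
  have split: "coset_load S (W \<union> (+) v ` W) x = coset_load S W x + coset_load S W (x + v)"
    if "v \<notin> W" for v x
  proof -
    have "{s \<in> S. s - x \<in> W \<union> (+) v ` W} = {s \<in> S. s - x \<in> W} \<union> {s \<in> S. s - (x + v) \<in> W}"
      by (auto simp: mem_translate_iff diff_diff_eq)
    moreover have "{s \<in> S. s - x \<in> W} \<inter> {s \<in> S. s - (x + v) \<in> W} = {}"
    proof -
      have False if "s - x \<in> W" "s - (x + v) \<in> W" for s
      proof -
        have "(s - x) + - (s - (x + v)) \<in> W"
          using that by (intro add) (simp_all only: minus)
        then show False using \<open>v \<notin> W\<close> by simp
      qed
      then show ?thesis by blast
    qed
    ultimately show ?thesis
      unfolding coset_load_def by (simp add: card_Un_disjoint)
  qed
  have mgf: "coset_mgf c S (W \<union> (+) v ` W) = (\<Sum>x\<in>UNIV. g x * g (x + v)) / N" if "v \<notin> W" for v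
    using that by (simp add: coset_mgf_def split g_def exp_add[symmetric] distrib_left N_def)
  have tot: "(\<Sum>v\<in>UNIV. \<Sum>x\<in>UNIV. g x * g (x + v)) = G\<^sup>2"
  proof -
    have "(\<Sum>v\<in>UNIV. g (x + v)) = G" for x
    proof -
      have "bij ((+) x)" by (rule bij_plus)
      then show ?thesis unfolding G_def by (rule sum.reindex_bij_betw)
    qed
    then show ?thesis
      by (subst sum.swap) (simp add: sum_distrib_left[symmetric] sum_distrib_right[symmetric] G_def power2_eq_square)
  qed
  have inW: "(\<Sum>v\<in>W. \<Sum>x\<in>UNIV. g x * g (x + v)) = real (card W) * (\<Sum>x\<in>UNIV. (g x)\<^sup>2)"
    by (simp add: inv power2_eq_square)
  \<comment> \<open>Cauchy-Schwarz: the omitted terms are at least as large as the average.\<close>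
  have cs: "G\<^sup>2 \<le> N * (\<Sum>x\<in>UNIV. (g x)\<^sup>2)"
    using sum_squared_le_sum_of_squares[of g UNIV] by (simp add: G_def N_def mult.commute)
  have "(\<Sum>v\<in>- W. coset_mgf c S (W \<union> (+) v ` W)) = (\<Sum>v\<in>- W. \<Sum>x\<in>UNIV. g x * g (x + v)) / N"
    by (simp add: mgf sum_divide_distrib)
  also have "(\<Sum>v\<in>- W. \<Sum>x\<in>UNIV. g x * g (x + v)) = G\<^sup>2 - real (card W) * (\<Sum>x\<in>UNIV. (g x)\<^sup>2)"
    using tot inW sum_diff[of UNIV W "\<lambda>v. \<Sum>x\<in>UNIV. g x * g (x + v)"] by (simp add: Compl_eq_Diff_UNIV)
  also have "(G\<^sup>2 - real (card W) * (\<Sum>x\<in>UNIV. (g x)\<^sup>2)) / N \<le> (G\<^sup>2 - real (card W) * (G\<^sup>2 / N)) / N"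
    using cs N by (intro divide_right_mono diff_left_mono mult_left_mono) (auto simp: field_simps)
  also have "\<dots> = real (card (- W)) * Q\<^sup>2"
  proof -
    have eq: "real (card (- W)) = N - real (card W)"
      by (simp add: Compl_eq_Diff_UNIV card_Diff_subset N_def of_nat_diff card_mono)
    show ?thesis unfolding eq Q_eq using N by (simp add: field_simps power2_eq_square)
  qed
  finally have avg: "(\<Sum>v\<in>- W. coset_mgf c S (W \<union> (+) v ` W)) \<le> real (card (- W)) * Q\<^sup>2" .
  \<comment> \<open>The tangent line of \<open>ln\<close> at the square of \<open>Q\<close>; its
    linear correction sums to at most 0 by \<open>avg\<close>.\<close>
  have "ln (coset_mgf c S (W \<union> (+) v ` W)) \<le> 2 * ln Q + (coset_mgf c S (W \<union> (+) v ` W) / Q\<^sup>2 - 1)" for v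
  proof -
    have "ln (coset_mgf c S (W \<union> (+) v ` W) / Q\<^sup>2) \<le> coset_mgf c S (W \<union> (+) v ` W) / Q\<^sup>2 - 1"
      using Q coset_mgf_pos[of c S "W \<union> (+) v ` W"] by (intro ln_le_minus_one) auto
    then show ?thesis
      using Q coset_mgf_pos[of c S "W \<union> (+) v ` W"] by (simp add: ln_div ln_realpow)
  qed
  then have "(\<Sum>v\<in>- W. ln (coset_mgf c S (W \<union> (+) v ` W)))
      \<le> (\<Sum>v\<in>- W. 2 * ln Q + (coset_mgf c S (W \<union> (+) v ` W) / Q\<^sup>2 - 1))"
    by (intro sum_mono)
  also have "\<dots> = real (card (- W)) * (2 * ln Q)
      + ((\<Sum>v\<in>- W. coset_mgf c S (W \<union> (+) v ` W)) / Q\<^sup>2 - real (card (- W)))"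
    by (simp add: sum.distrib sum_subtractf sum_divide_distrib algebra_simps)
  also have "\<dots> \<le> real (card (- W)) * (2 * ln Q)"
    using avg Q by (simp add: pos_divide_le_eq)
  finally show ?thesis by (simp add: Q_def)
qed

section \<open>Ordered bases over the field with two elements\<close>

lemma UNIV_bit: "(UNIV :: bit set) = {0, 1}"
  using bit_not_one_iff by blast

lemma ex_bit_iff: "(\<exists>b :: bit. P b) \<longleftrightarrow> P 0 \<or> P 1"
proof
  assume "\<exists>b. P b"
  then obtain b where "P b" by blast
  then show "P 0 \<or> P 1" by (cases b) simp_all
qed blast

instance bit :: finite
  by standard (simp add: UNIV_bit)

lemma CARD_bit: "CARD(bit) = 2"
  by (simp add: UNIV_bit)

lemma bit_vec_add_self: "v + v = (0 :: bit ^ 'u)"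
  by (simp add: vec_eq_iff)

text \<open>The only scalars are 0 and 1, so closure under scaling comes for free. Additive maps are
  linear for the same reason.\<close>

lemma bit_vec_subspace_iff:
  "vec.subspace W \<longleftrightarrow> (0 :: bit ^ 'u) \<in> W \<and> (\<forall>v\<in>W. \<forall>w\<in>W. v + w \<in> W)"
proof
  assume W: "0 \<in> W \<and> (\<forall>v\<in>W. \<forall>w\<in>W. v + w \<in> W)"
  have "a *s w \<in> W" if "w \<in> W" for a w
    using W that by (cases a) auto
  with W show "vec.subspace W" by (auto simp: vec.subspace_def)
qed (auto simp: vec.subspace_def)

lemma bit_vec_linear_iff:
  "Vector_Spaces.linear (*s) (*s) h \<longleftrightarrow> (\<forall>x y :: bit ^ 'u. h (x + y) = (h x + h y :: bit ^ 'l))"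
proof
  assume h: "\<forall>x y. h (x + y) = h x + h y"
  then have "h (0 + 0) = h 0 + h 0" by blast
  then have "h 0 = 0" by simp
  then have "h (a *s x) = a *s h x" for a x by (cases a) auto
  with h show "Vector_Spaces.linear (*s) (*s) h"
    by (simp add: Vector_Spaces.linear_iff vec.vector_space_axioms)
qed (simp add: Vector_Spaces.linear_iff)

text \<open>Adjoining a vector to a span has the form studied above, the union with one
  translate.\<close>

lemma bit_vec_span_insert:
  "vec.span (insert v B) = vec.span B \<union> (+) v ` vec.span (B :: (bit ^ 'u) set)"
proof -
  have "x \<in> vec.span (insert v B) \<longleftrightarrow> x \<in> vec.span B \<or> x - v \<in> vec.span B" for x
    by (simp only: vec.span_insert mem_Collect_eq ex_bit_iff vec.scale_zero_left vec.scale_one diff_zero)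
  then show ?thesis by (simp only: set_eq_iff Un_iff mem_translate_iff simp_thms)
qed

text \<open>Ordered lists, newest vector at the head. Over the whole space, a uniform list amounts
  to repeatedly adjoining a uniform vector from outside the current span.\<close>

primrec indep_lists :: "(bit ^ 'u) set \<Rightarrow> nat \<Rightarrow> (bit ^ 'u) list set" where
  "indep_lists W 0 = {[]}"
| "indep_lists W (Suc i) = (\<lambda>(vs, v). v # vs) ` (SIGMA vs : indep_lists W i. W - vec.span (set vs))"

lemma finite_indep_lists: "finite (indep_lists W i)"
  by (induction i) auto

lemma sum_indep_lists_Suc:
  "(\<Sum>vs\<in>indep_lists W (Suc i). F vs)
    = (\<Sum>vs\<in>indep_lists W i. \<Sum>v\<in>W - vec.span (set vs). F (v # vs))"
proof -
  have inj: "inj_on (\<lambda>(vs, v). v # vs) (SIGMA vs : indep_lists W i. W - vec.span (set vs))"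
    by (auto simp: inj_on_def)
  show ?thesis
    unfolding indep_lists.simps(2) sum.reindex[OF inj]
    by (simp add: sum.Sigma finite_indep_lists case_prod_beta)
qed

lemma indep_lists_iff:
  "vs \<in> indep_lists W i \<longleftrightarrow> vs \<in> indep_lists UNIV i \<and> set vs \<subseteq> W"
proof (induction i arbitrary: vs)
  case (Suc i)
  show ?case
  proof (cases vs)
    case (Cons v ws)
    have step: "v # ws \<in> indep_lists U (Suc i)
        \<longleftrightarrow> ws \<in> indep_lists U i \<and> v \<in> U - vec.span (set ws)" for U
      by auto
    show ?thesis unfolding Cons step using Suc.IH[of ws] by auto
  qed auto
qed auto

text \<open>Each new vector doubles the span, because the span and its translate by that vector are
  disjoint.\<close>

lemma indep_lists_props:
  assumes "vs \<in> indep_lists W i"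
  shows "length vs = i" "distinct vs" "vec.independent (set vs)" "card (vec.span (set vs)) = 2 ^ i"
proof -
  have "length vs = i \<and> distinct vs \<and> vec.independent (set vs) \<and> card (vec.span (set vs)) = 2 ^ i"
    using assms
  proof (induction i arbitrary: vs)
    case 0
    then show ?case by (simp add: vec.independent_empty)
  next
    case (Suc i)
    then obtain v ws where vs: "vs = v # ws" and ws: "ws \<in> indep_lists W i" and v: "v \<notin> vec.span (set ws)"
      by auto
    have IH: "length ws = i" "distinct ws" "vec.independent (set ws)" "card (vec.span (set ws)) = 2 ^ i"
      using Suc.IH[OF ws] by auto
    have "v \<notin> set ws" using v vec.span_base by blast
    moreover have "vec.span (set ws) \<inter> (+) v ` vec.span (set ws) = {}"
    proof -
      have False if "w \<in> vec.span (set ws)" "v + w \<in> vec.span (set ws)" for w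
        using vec.span_diff[OF that(2,1)] v by simp
      then show ?thesis by blast
    qed
    ultimately show ?case
      using IH v by (simp add: vs bit_vec_span_insert card_Un_disjoint card_image vec.independent_insert)
  qed
  then show "length vs = i" "distinct vs" "vec.independent (set vs)" "card (vec.span (set vs)) = 2 ^ i"
    by auto
qed

text \<open>The number of choices for the next vector depends only on the length of the list.
  Truncated subtraction is harmless: once no list is left, the product is already 0.\<close>

lemma card_indep_lists:
  assumes "vec.subspace W"
  shows "card (indep_lists W i) = (\<Prod>j<i. card W - 2 ^ j)"
proof (induction i)
  case (Suc i)
  have "card (W - vec.span (set vs)) = card W - 2 ^ i" if "vs \<in> indep_lists W i" for vs
  proof -
    have "vec.span (set vs) \<subseteq> W"
      using that assms by (intro vec.span_minimal) (auto simp: indep_lists_iff[of vs W])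
    then show ?thesis using indep_lists_props(4)[OF that] by (simp add: card_Diff_subset)
  qed
  moreover have "card (indep_lists W (Suc i)) = (\<Sum>vs\<in>indep_lists W i. card (W - vec.span (set vs)))"
    using sum_indep_lists_Suc[of "\<lambda>_. 1::nat" W i] by simp
  ultimately show ?case using Suc by simp
qed simp

lemma card_indep_lists_pos:
  assumes "k \<le> CARD('u)"
  shows "card (indep_lists (UNIV :: (bit ^ 'u) set) k) > 0"
proof -
  have "(2 :: nat) ^ j < 2 ^ CARD('u)" if "j < k" for j
    using that assms by (intro power_strict_increasing) auto
  then show ?thesis
    by (subst card_indep_lists[OF vec.subspace_UNIV]) (auto simp: CARD_bit intro!: prod_pos)
qed

text \<open>The lists on the left are the ordered bases of \<open>W\<close>: a span inside
  \<open>W\<close> with as many elements as \<open>W\<close> is \<open>W\<close>.\<close>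

lemma indep_lists_eq_bases:
  assumes "vec.subspace W" "card W = 2 ^ i"
  shows "indep_lists W i = {vs \<in> indep_lists UNIV i. vec.span (set vs) = W}"
proof -
  have "set vs \<subseteq> W \<longleftrightarrow> vec.span (set vs) = W" if "vs \<in> indep_lists UNIV i" for vs
  proof
    assume "set vs \<subseteq> W"
    then have "vec.span (set vs) \<subseteq> W" using assms by (intro vec.span_minimal) auto
    then show "vec.span (set vs) = W"
      using indep_lists_props(4)[OF that] assms by (intro card_subset_eq) auto
  qed (use vec.span_superset in blast)
  then show ?thesis by (subst set_eq_iff, subst indep_lists_iff) auto
qed

text \<open>Iterates the adjoining inequality. All lists of length \<open>i\<close> have the same
  number of extensions, so the mean of the logarithm at most doubles at each step.\<close>

lemma average_ln_coset_mgf_indep_lists_le: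
  fixes S :: "(bit ^ 'u) set"
  shows "(\<Sum>vs\<in>indep_lists UNIV i. ln (coset_mgf c S (vec.span (set vs))))
    \<le> real (card (indep_lists (UNIV :: (bit ^ 'u) set) i)) * (2 ^ i * ln (coset_mgf c S {0}))"
proof (induction i)
  case 0
  then show ?case by simp
next
  case (Suc i)
  let ?L = "\<lambda>vs. ln (coset_mgf c S (vec.span (set vs)))"
  let ?T = "indep_lists (UNIV :: (bit ^ 'u) set) i"
  let ?d = "card (UNIV :: (bit ^ 'u) set) - 2 ^ i"
  have card: "card (- vec.span (set vs)) = ?d" if "vs \<in> ?T" for vs
    using indep_lists_props(4)[OF that] by (simp add: Compl_eq_Diff_UNIV card_Diff_subset)
  have "(\<Sum>vs\<in>indep_lists UNIV (Suc i). ?L vs)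
      = (\<Sum>vs\<in>?T. \<Sum>v\<in>- vec.span (set vs). ln (coset_mgf c S (vec.span (set vs) \<union> (+) v ` vec.span (set vs))))"
    unfolding sum_indep_lists_Suc by (simp add: bit_vec_span_insert Compl_eq_Diff_UNIV)
  also have "\<dots> \<le> (\<Sum>vs\<in>?T. real ?d * (2 * ?L vs))"
  proof (intro sum_mono)
    fix vs assume "vs \<in> ?T"
    then show "(\<Sum>v\<in>- vec.span (set vs). ln (coset_mgf c S (vec.span (set vs) \<union> (+) v ` vec.span (set vs))))
        \<le> real ?d * (2 * ?L vs)"
      using average_ln_coset_mgf_adjoin_le[of "vec.span (set vs)" c S, OF bit_vec_add_self]
      by (simp add: vec.span_add card)
  qed
  also have "\<dots> = real ?d * 2 * (\<Sum>vs\<in>?T. ?L vs)"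
    by (simp add: sum_distrib_left mult.assoc)
  also have "\<dots> \<le> real ?d * 2 * (real (card ?T) * (2 ^ i * ln (coset_mgf c S {0})))"
    by (intro mult_left_mono Suc) auto
  also have "\<dots> = real (card ?T * ?d) * (2 ^ Suc i * ln (coset_mgf c S {0}))"
    by simp
  also have "card ?T * ?d = card (indep_lists (UNIV :: (bit ^ 'u) set) (Suc i))"
    by (simp only: card_indep_lists[OF vec.subspace_UNIV] prod.lessThan_Suc)
  finally show ?case .
qed

section \<open>Kernels of random surjective linear maps\<close>

lemma surj_linear_maps_iff:
  "h \<in> surj_linear_maps \<longleftrightarrow> (\<forall>x y :: bit ^ 'u. h (x + y) = (h x + h y :: bit ^ 'l)) \<and> surj h"
  by (simp add: surj_linear_maps_def bit_vec_linear_iff)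

lemma surj_linear_maps_add:
  "h \<in> surj_linear_maps \<Longrightarrow> h (x + y) = h x + h y"
  by (simp add: surj_linear_maps_iff)

lemma surj_linear_maps_zero: "h \<in> surj_linear_maps \<Longrightarrow> h 0 = 0"
  using surj_linear_maps_add[of h 0 0] by simp

lemma surj_linear_maps_diff:
  "h \<in> surj_linear_maps \<Longrightarrow> h (x - y) = h x - h y"
  using surj_linear_maps_add[of h "x - y" y] by simp

lemma surj_linear_maps_surj: "h \<in> surj_linear_maps \<Longrightarrow> surj h"
  by (simp add: surj_linear_maps_iff)

lemma subspace_kernel: "h \<in> surj_linear_maps \<Longrightarrow> vec.subspace (h -` {0})"
  by (simp add: bit_vec_subspace_iff surj_linear_maps_zero surj_linear_maps_add)

text \<open>The fibres of \<open>h\<close> are translates of the kernel and partition the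
  domain.\<close>

lemma card_kernel:
  fixes h :: "bit ^ 'u \<Rightarrow> bit ^ 'l"
  assumes h: "h \<in> surj_linear_maps" and k: "CARD('u) = k + CARD('l)"
  shows "card (h -` {0}) = 2 ^ k"
proof -
  have fib: "card (h -` {y}) = card (h -` {0})" for y
  proof -
    obtain x where y: "y = h x" using surjD[OF surj_linear_maps_surj[OF h], of y] ..
    have "h -` {y} = (+) x ` (h -` {0})"
      unfolding set_eq_iff mem_translate_iff vimage_singleton_eq surj_linear_maps_diff[OF h] y by simp
    then show ?thesis by (simp add: card_image)
  qed
  have "card (UNIV :: (bit ^ 'u) set) = card (\<Union>y. h -` {y})"
    by (rule arg_cong[where f = card]) auto
  also have "\<dots> = (\<Sum>y\<in>UNIV. card (h -` {y}))"
    by (rule card_UN_disjoint) auto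
  also have "\<dots> = (\<Sum>y\<in>(UNIV :: (bit ^ 'l) set). card (h -` {0}))"
    by (intro sum.cong refl fib)
  also have "\<dots> = 2 ^ CARD('l) * card (h -` {0})"
    by (simp add: CARD_bit)
  finally have "2 ^ CARD('l) * card (h -` {0}) = 2 ^ CARD('l) * 2 ^ k"
    by (simp add: CARD_bit k power_add)
  then show ?thesis by simp
qed

text \<open>Extend \<open>vs\<close> to a basis, send \<open>vs\<close> to 0 and the remaining basis
  vectors bijectively to the standard basis of the target. The kernel contains the span of
  \<open>vs\<close>, and equality follows by comparing sizes.\<close>

lemma ex_surj_linear_map_kernel:
  fixes vs :: "(bit ^ 'u) list"
  assumes vs: "vs \<in> indep_lists UNIV k" and k: "CARD('u) = k + CARD('l)"
  obtains h :: "bit ^ 'u \<Rightarrow> bit ^ 'l" where "h \<in> surj_linear_maps" "h -` {0} = vec.span (set vs)"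
proof -
  note props = indep_lists_props[OF vs]
  obtain B where B: "set vs \<subseteq> B" "B \<subseteq> UNIV" "vec.independent B" "UNIV \<subseteq> vec.span B"
    using vec.maximal_independent_subset_extend[OF subset_UNIV props(3)] .
  have "card B = CARD('u)"
    using vec.basis_card_eq_dim[OF B(2,4,3)]
    by (simp add: card_cart_basis)
  moreover have "card (set vs) = k" using props by (simp add: distinct_card)
  ultimately have "card (B - set vs) = CARD('l)"
    using B(1) k by (simp add: card_Diff_subset)
  then obtain g where g: "bij_betw g (B - set vs) (cart_basis :: (bit ^ 'l) set)"
    using finite_same_card_bij[of "B - set vs" "cart_basis :: (bit ^ 'l) set"]
    by (auto simp: card_cart_basis)
  define f where "f x = (if x \<in> set vs then 0 else g x)" for x
  obtain h :: "bit ^ 'u \<Rightarrow> bit ^ 'l" where lin: "Vector_Spaces.linear (*s) (*s) h"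
    and hf: "\<forall>x\<in>B. h x = f x" and range: "range h = vec.span (f ` B)"
    using vec.linear_independent_extend_subspace[OF B(3), of f] by blast
  have "f ` (B - set vs) = g ` (B - set vs)" by (intro image_cong) (simp_all add: f_def)
  then have "cart_basis \<subseteq> f ` B"
    using bij_betw_imp_surj_on[OF g] by blast
  then have "surj h"
    using vec.span_mono[of cart_basis "f ` B"] range by auto
  with lin have h: "h \<in> surj_linear_maps" by (simp add: surj_linear_maps_def)
  have "set vs \<subseteq> h -` {0}" using hf B(1) by (auto simp: f_def)
  then have "vec.span (set vs) \<subseteq> h -` {0}"
    by (rule vec.span_minimal[OF _ subspace_kernel[OF h]])
  then have "h -` {0} = vec.span (set vs)"
    using card_kernel[OF h k] props(4) by (intro card_subset_eq[symmetric]) simp_all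
  with h show ?thesis by (rule that)
qed

text \<open>Two surjections with the same kernel differ by an automorphism of the target.\<close>

lemma card_surj_linear_maps_kernel:
  fixes h\<^sub>0 :: "bit ^ 'u \<Rightarrow> bit ^ 'l"
  assumes h0: "h\<^sub>0 \<in> surj_linear_maps"
  shows "card {h \<in> surj_linear_maps :: (bit ^ 'u \<Rightarrow> bit ^ 'l) set. h -` {0} = h\<^sub>0 -` {0}}
    = card (surj_linear_maps :: (bit ^ 'l \<Rightarrow> bit ^ 'l) set)"
proof -
  let ?H = "{h \<in> surj_linear_maps :: (bit ^ 'u \<Rightarrow> bit ^ 'l) set. h -` {0} = h\<^sub>0 -` {0}}"
  let ?G = "surj_linear_maps :: (bit ^ 'l \<Rightarrow> bit ^ 'l) set"
  have surj0: "surj h\<^sub>0" using h0 by (rule surj_linear_maps_surj)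
  have "inj_on (\<lambda>p. p \<circ> h\<^sub>0) ?G"
    using surj0 by (auto simp: inj_on_def fun_eq_iff) (metis surjD)
  moreover have "(\<lambda>p. p \<circ> h\<^sub>0) ` ?G = ?H"
  proof (intro equalityI subsetI)
    fix h assume "h \<in> (\<lambda>p. p \<circ> h\<^sub>0) ` ?G"
    then obtain p where p: "p \<in> ?G" and h: "h = p \<circ> h\<^sub>0" by auto
    \<comment> \<open>A surjection of a finite set onto itself is injective, so composing with
      \<open>p\<close> leaves the kernel unchanged.\<close>
    have "inj p"
      using surj_linear_maps_surj[OF p] by (intro finite_UNIV_surj_inj) auto
    then have "p y = 0 \<longleftrightarrow> y = 0" for y
      using surj_linear_maps_zero[OF p] by (metis injD)
    moreover have "h \<in> surj_linear_maps"
      using p h0 comp_surj[OF surj0 surj_linear_maps_surj[OF p]] by (simp add: h surj_linear_maps_iff)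
    ultimately show "h \<in> ?H" by (auto simp: h)
  next
    fix h assume h: "h \<in> ?H"
    then have hH: "h \<in> surj_linear_maps" and ker: "h x = 0 \<longleftrightarrow> h\<^sub>0 x = 0" for x by auto
    \<comment> \<open>The choice of preimage is immaterial: two preimages under
      \<open>h\<^sub>0\<close> differ by an element of the common kernel.\<close>
    define p where "p y = h (inv h\<^sub>0 y)" for y
    have p: "p (h\<^sub>0 x) = h x" for x
    proof -
      have "h\<^sub>0 (inv h\<^sub>0 (h\<^sub>0 x) - x) = 0"
        by (simp add: surj_linear_maps_diff[OF h0] surj_f_inv_f[OF surj0])
      then have "h (inv h\<^sub>0 (h\<^sub>0 x) - x) = 0" by (simp add: ker)
      then show ?thesis by (simp add: p_def surj_linear_maps_diff[OF hH])
    qed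
    have "p (y + z) = p y + p z" for y z
    proof -
      obtain x x' where "y = h\<^sub>0 x" "z = h\<^sub>0 x'" using surj0 by (metis surjD)
      then show ?thesis
        by (simp add: p surj_linear_maps_add[OF h0, symmetric] surj_linear_maps_add[OF hH])
    qed
    moreover have "surj p"
      using surj_linear_maps_surj[OF hH] p by (metis surj_def)
    ultimately have "p \<in> ?G" by (simp add: surj_linear_maps_iff)
    moreover have "h = p \<circ> h\<^sub>0" by (simp add: fun_eq_iff p)
    ultimately show "h \<in> (\<lambda>p. p \<circ> h\<^sub>0) ` ?G" by blast
  qed
  ultimately show ?thesis by (metis card_image)
qed

section \<open>Averages over random kernels and the fullest bin\<close>

lemma surj_linear_maps_nonempty:
  assumes k: "CARD('u) = k + CARD('l)"
  shows "(surj_linear_maps :: (bit ^ 'u \<Rightarrow> bit ^ 'l) set) \<noteq> {}"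
proof -
  obtain vs where vs: "vs \<in> indep_lists (UNIV :: (bit ^ 'u) set) k"
    using card_indep_lists_pos[where 'u = 'u, of k] k by (auto simp: card_gt_0_iff)
  obtain h :: "bit ^ 'u \<Rightarrow> bit ^ 'l" where "h \<in> surj_linear_maps" "h -` {0} = vec.span (set vs)"
    using ex_surj_linear_map_kernel[OF vs k] .
  then show ?thesis by blast
qed

text \<open>The kernel of a uniform \<open>h\<close> and the span of a uniform list of
  \<open>k\<close> independent vectors are equally distributed. This is double counting of the pairs
  with span equal to kernel, stated without division.\<close>

lemma average_over_kernels:
  fixes F :: "(bit ^ 'u) set \<Rightarrow> real"
  assumes k: "CARD('u) = k + CARD('l)"
  defines "H \<equiv> surj_linear_maps :: (bit ^ 'u \<Rightarrow> bit ^ 'l) set"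
    and "T \<equiv> indep_lists (UNIV :: (bit ^ 'u) set) k"
  shows "real (card T) * (\<Sum>h\<in>H. F (h -` {0})) = real (card H) * (\<Sum>vs\<in>T. F (vec.span (set vs)))"
proof -
  \<comment> \<open>\<open>b\<close> counts the ordered bases of a kernel, \<open>g\<close> the
    automorphisms of the target. They are the numbers of partners of a map and of a list,
    respectively.\<close>
  define b where "b = (\<Prod>j<k. 2 ^ k - 2 ^ j :: nat)"
  define g where "g = card (surj_linear_maps :: (bit ^ 'l \<Rightarrow> bit ^ 'l) set)"
  have b: "b > 0" unfolding b_def by (intro prod_pos) auto
  have finT: "finite T" by (simp add: T_def finite_indep_lists)
  have cT: "card {vs \<in> T. vec.span (set vs) = h -` {0}} = b" if "h \<in> H" for h
  proof -
    note h = that[unfolded H_def]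
    show ?thesis
      using indep_lists_eq_bases[OF subspace_kernel[OF h] card_kernel[OF h k]]
        card_indep_lists[OF subspace_kernel[OF h], of k] card_kernel[OF h k]
      by (simp add: T_def b_def)
  qed
  have cH: "card {h \<in> H. vec.span (set vs) = h -` {0}} = g" if vs: "vs \<in> T" for vs
  proof -
    obtain h0 :: "bit ^ 'u \<Rightarrow> bit ^ 'l" where "h0 \<in> surj_linear_maps" "h0 -` {0} = vec.span (set vs)"
      using ex_surj_linear_map_kernel[OF vs[unfolded T_def] k] .
    then show ?thesis
      using card_surj_linear_maps_kernel[of h0] by (simp add: H_def g_def eq_commute)
  qed
  have count_H: "(\<Sum>h\<in>H. if P h then z else 0) = real (card {h \<in> H. P h}) * z" for P and z :: real
    by (simp add: sum.If_cases Int_def)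
  have key: "real b * (\<Sum>h\<in>H. F (h -` {0})) = real g * (\<Sum>vs\<in>T. F (vec.span (set vs)))"
    for F :: "(bit ^ 'u) set \<Rightarrow> real"
  proof -
    have "real b * (\<Sum>h\<in>H. F (h -` {0}))
        = (\<Sum>h\<in>H. \<Sum>vs\<in>T. if vec.span (set vs) = h -` {0} then F (h -` {0}) else 0)"
      using finT by (simp add: sum.If_cases Int_def cT sum_distrib_left)
    also have "\<dots> = (\<Sum>vs\<in>T. \<Sum>h\<in>H. if vec.span (set vs) = h -` {0} then F (vec.span (set vs)) else 0)"
      by (subst sum.swap) (intro sum.cong, auto)
    also have "\<dots> = (\<Sum>vs\<in>T. real (card {h \<in> H. vec.span (set vs) = h -` {0}}) * F (vec.span (set vs)))"
      by (simp only: count_H)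
    also have "\<dots> = real g * (\<Sum>vs\<in>T. F (vec.span (set vs)))"
      by (simp add: cH sum_distrib_left)
    finally show ?thesis .
  qed
  \<comment> \<open>The constant function 1 yields the relation that eliminates \<open>b\<close> and
    \<open>g\<close>.\<close>
  have one: "real b * real (card H) = real g * real (card T)"
    using key[of "\<lambda>_. 1"] by simp
  have "real b * (real (card T) * (\<Sum>h\<in>H. F (h -` {0})))
      = real (card T) * (real b * (\<Sum>h\<in>H. F (h -` {0})))"
    by (simp only: mult.left_commute)
  also have "\<dots> = (real g * real (card T)) * (\<Sum>vs\<in>T. F (vec.span (set vs)))"
    by (simp only: key mult.left_commute mult.assoc)
  also have "\<dots> = real b * (real (card H) * (\<Sum>vs\<in>T. F (vec.span (set vs))))"
    by (simp only: one[symmetric] mult.assoc)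
  finally show ?thesis using b by simp
qed

text \<open>By surjectivity the fullest bin is the fibre of some \<open>h x\<close>, a coset of the
  kernel.\<close>

lemma max_load_eq_coset_load:
  fixes h :: "bit ^ 'u \<Rightarrow> bit ^ 'l"
  assumes h: "h \<in> surj_linear_maps"
  obtains x where "max_load S h = coset_load S (h -` {0}) x"
proof -
  have "max_load S h \<in> range (\<lambda>y. card (h -` {y} \<inter> S))"
    unfolding max_load_def by (intro Max_in) auto
  then obtain y where y: "max_load S h = card (h -` {y} \<inter> S)" by auto
  obtain x where "y = h x" using surj_linear_maps_surj[OF h] by (metis surjD)
  then have "h -` {y} \<inter> S = {s \<in> S. s - x \<in> h -` {0}}"
    by (auto simp: surj_linear_maps_diff[OF h])
  with y that show ?thesis by (simp add: coset_load_def)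
qed

section \<open>The tail bound\<close>

text \<open>Markov's inequality for the logarithm of the potential of the kernel minus its lower
  bound \<open>c * a\<close>.\<close>

lemma max_load_tail:
  fixes S :: "(bit ^ 'u) set"
  assumes k: "CARD('u) = k + CARD('l)" and c: "c \<ge> 0"
    and n: "n = 2 ^ CARD('l)" and a: "a = real (card S) / n"
    and D: "c * (t - a) - ln n > 0"
  shows "measure_pmf.prob (pmf_of_set (surj_linear_maps :: (bit ^ 'u \<Rightarrow> bit ^ 'l) set))
           {h. real (max_load S h) \<ge> t} \<le> a * (exp c - 1 - c) / (c * (t - a) - ln n)"
proof -
  let ?H = "surj_linear_maps :: (bit ^ 'u \<Rightarrow> bit ^ 'l) set"
  let ?A = "{h :: bit ^ 'u \<Rightarrow> bit ^ 'l. real (max_load S h) \<ge> t}"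
  let ?T = "indep_lists (UNIV :: (bit ^ 'u) set) k"
  let ?L = "\<lambda>W. ln (coset_mgf c S W)"
  have ne: "?H \<noteq> {}" using k by (rule surj_linear_maps_nonempty)
  then have H0: "card ?H > 0" by (simp add: card_gt_0_iff)
  have N: "real (card (UNIV :: (bit ^ 'u) set)) = 2 ^ k * n"
    by (simp add: CARD_bit k n power_add)
  have n0: "n > 0" by (simp add: n)
  have cross: "x / y \<le> e / d" if "x * d \<le> y * e" "y > 0" "d > 0" for x y d e :: real
    using that by (simp add: field_simps)
  have mean: "c * a \<le> ?L (h -` {0})" if "h \<in> ?H" for h
    using ln_coset_mgf_ge_mean[of c S "h -` {0}"] card_kernel[OF that k] unfolding N
    by (simp add: a)
  have load: "c * t - ln n \<le> ?L (h -` {0})" if h: "h \<in> ?H" and t: "h \<in> ?A" for h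
  proof -
    obtain x where x: "max_load S h = coset_load S (h -` {0}) x"
      using max_load_eq_coset_load[OF h] .
    have "c * real (coset_load S (h -` {0}) x)
        - ln (real (card (UNIV :: (bit ^ 'u) set)) / real (card (h -` {0}))) \<le> ?L (h -` {0})"
    proof (rule ln_coset_mgf_ge_load)
      show "h -` {0} \<noteq> {}" using vec.subspace_0[OF subspace_kernel[OF h]] by blast
    qed (rule vec.subspace_add[OF subspace_kernel[OF h]] vec.subspace_neg[OF subspace_kernel[OF h]]; assumption)+
    then have "c * real (max_load S h) - ln n \<le> ?L (h -` {0})"
      using card_kernel[OF h k] unfolding N by (simp add: x)
    moreover have "c * t \<le> c * real (max_load S h)"
      using t c by (intro mult_left_mono) auto
    ultimately show ?thesis by simp
  qed
  have T0: "card ?T > 0" using k by (intro card_indep_lists_pos) simp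
  have "real (card ?T) * (\<Sum>h\<in>?H. ?L (h -` {0})) = real (card ?H) * (\<Sum>vs\<in>?T. ?L (vec.span (set vs)))"
    by (rule average_over_kernels[OF k])
  also have "\<dots> \<le> real (card ?H) * (real (card ?T) * (2 ^ k * ?L {0}))"
    by (intro mult_left_mono average_ln_coset_mgf_indep_lists_le) auto
  finally have "(\<Sum>h\<in>?H. ?L (h -` {0})) \<le> real (card ?H) * (2 ^ k * ?L {0})"
    using T0 by (simp add: mult.left_commute[of "real (card ?H)"])
  \<comment> \<open>The factor \<open>2 ^ k\<close> from \<open>k\<close> doublings cancels against
    the kernel size in the density of \<open>S\<close>.\<close>
  also have "\<dots> \<le> real (card ?H) * (2 ^ k * (real (card S) / (2 ^ k * n) * (exp c - 1)))"
    using ln_coset_mgf_zero_le[of c S] unfolding N by (intro mult_left_mono) auto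
  also have "\<dots> = real (card ?H) * (a * (exp c - 1))"
    using n0 by (simp add: a)
  finally have total: "(\<Sum>h\<in>?H. ?L (h -` {0}) - c * a) \<le> real (card ?H) * (a * (exp c - 1 - c))"
    by (simp add: sum_subtractf algebra_simps)
  \<comment> \<open>Maps in \<open>?A\<close> contribute at least the threshold each, and all other
    terms are nonnegative by \<open>mean\<close>.\<close>
  have "real (card (?H \<inter> ?A)) * (c * (t - a) - ln n) = (\<Sum>h\<in>?H \<inter> ?A. c * t - ln n - c * a)"
    by (simp add: algebra_simps)
  also have "\<dots> \<le> (\<Sum>h\<in>?H \<inter> ?A. ?L (h -` {0}) - c * a)"
    using load by (intro sum_mono) auto
  also have "\<dots> \<le> (\<Sum>h\<in>?H. ?L (h -` {0}) - c * a)"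
    using mean by (intro sum_mono2) auto
  also note total
  finally have "real (card (?H \<inter> ?A)) / real (card ?H) \<le> a * (exp c - 1 - c) / (c * (t - a) - ln n)"
    using H0 D by (intro cross) auto
  then show ?thesis using ne by (simp add: measure_pmf_of_set)
qed

section \<open>Estimates for the exponent and the two regimes of \<open>opt\<close>\<close>

lemma exp_minus_one_minus_self_le:
  fixes x :: real
  assumes "x \<ge> 0"
  shows "exp x - 1 - x \<le> x\<^sup>2 / 2 * exp x"
proof -
  \<comment> \<open>Second-order Taylor expansion at 0 with Lagrange remainder.\<close>
  obtain y where "\<bar>y\<bar> \<le> \<bar>x\<bar>" and "exp x = (\<Sum>i<2. x ^ i / fact i) + exp y / fact 2 * x ^ 2"
    using Maclaurin_exp_le[of x 2] by blast
  moreover have "exp y * x\<^sup>2 \<le> exp x * x\<^sup>2"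
    using \<open>\<bar>y\<bar> \<le> \<bar>x\<bar>\<close> assms by (intro mult_right_mono) auto
  ultimately show ?thesis by (simp add: eval_nat_numeral algebra_simps)
qed

text \<open>Here \<open>q = ln n / a\<close>, for which \<open>opt m n = ln n / ln q\<close>.\<close>

lemma sparse_tail_exponent:
  fixes q r :: real
  assumes q: "q > 1" and r: "r \<ge> 6"
  defines "c \<equiv> 2 * ln q / (r - 2)"
  shows "(exp c - 1 - c) / q \<le> 48 / (r - 2)\<^sup>2"
proof -
  have lq: "ln q > 0" using q by simp
  \<comment> \<open>The upper bound uses \<open>r - 2 \<ge> 4\<close>; it makes \<open>exp c\<close>
    at most the square root of \<open>q\<close>.\<close>
  have c: "c \<ge> 0" "c \<le> ln q / 2"
    using lq r by (auto simp: c_def field_simps)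
  \<comment> \<open>The fourth root is chosen so that the squared logarithm also costs only a square
    root of \<open>q\<close>; the two roots together cancel the denominator
    \<open>q\<close>.\<close>
  have "ln (q powr (1/4)) \<le> q powr (1/4)"
    using ln_less_self[of "q powr (1/4)"] q by simp
  then have "ln q \<le> 4 * q powr (1/4)" using q by (simp add: ln_powr)
  then have "(ln q)\<^sup>2 \<le> (4 * q powr (1/4))\<^sup>2"
    using lq by (intro power_mono) auto
  also have "\<dots> = 16 * q powr (1/2)"
    by (simp add: power2_eq_square powr_add[symmetric])
  finally have lq2: "(ln q)\<^sup>2 \<le> 16 * q powr (1/2)" .
  have "exp c \<le> q powr (1/2)"
    using c q by (simp add: powr_def)
  then have "(ln q)\<^sup>2 * exp c \<le> (16 * q powr (1/2)) * q powr (1/2)"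
    using lq2 by (intro mult_mono) auto
  also have "\<dots> = 16 * q"
    using q by (simp add: powr_add[symmetric])
  finally have *: "(ln q)\<^sup>2 * exp c \<le> 16 * q" .
  have "exp c - 1 - c \<le> c\<^sup>2 / 2 * exp c"
    using c by (intro exp_minus_one_minus_self_le)
  also have "\<dots> = 2 * ((ln q)\<^sup>2 * exp c) / (r - 2)\<^sup>2"
    by (simp add: c_def power_divide power_mult_distrib)
  also have "\<dots> \<le> 2 * (16 * q) / (r - 2)\<^sup>2"
    using * by (intro divide_right_mono mult_left_mono) auto
  also have "\<dots> \<le> 48 * q / (r - 2)\<^sup>2"
    using q by (intro divide_right_mono) auto
  finally show ?thesis using q by (simp add: field_simps)
qed

theorem theorem5p9:
  fixes u l m n :: nat and S :: "(bit ^ 'u) set" and r :: real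
  assumes "CARD('u) = u" and "CARD('l) = l" and "m \<ge> 1"
    and "real u \<ge> real l + 2 * log 2 (real l * real m)"
    and "n = 2 ^ l"
    and "card S = m"
    and "r \<ge> 6"
  shows "measure_pmf.prob (pmf_of_set (surj_linear_maps :: (bit ^ 'u \<Rightarrow> bit ^ 'l) set))
           {h. real (max_load S h) \<ge> r * opt m n} \<le> 48 / (r - 2)\<^sup>2"
proof -
  have l: "l \<ge> 1"
    using assms(2) by (metis One_nat_def Suc_leI zero_less_card_finite)
  \<comment> \<open>The logarithm in the hypothesis is nonnegative, so \<open>u \<ge> l\<close> and
    \<open>k\<close> is the dimension of the kernels.\<close>
  have "real l * real m \<ge> 1 * 1"
    using l assms(3) by (intro mult_mono) auto
  then have "log 2 (real l * real m) \<ge> 0" by simp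
  then have "u \<ge> l" using assms(4) by linarith
  then obtain k where k: "CARD('u) = k + CARD('l)"
    using assms(1,2) by (metis add.commute le_Suc_ex)
  define a where "a = real m / real n"
  have n: "real n = 2 ^ CARD('l)" using assms by simp
  have a: "a > 0" using assms by (simp add: a_def)
  have log_n: "log 2 (real n) = real l" using assms(5) by (simp add: log_nat_power)
  have ln_n: "ln (real n) = real l * ln 2" using assms(5) by (simp add: ln_realpow)
  have ln_n0: "ln (real n) > 0" using l by (simp add: ln_n)
  have tail: "measure_pmf.prob (pmf_of_set (surj_linear_maps :: (bit ^ 'u \<Rightarrow> bit ^ 'l) set))
           {h. real (max_load S h) \<ge> r * opt m n} \<le> a * (exp c - 1 - c) / d"
    if "c \<ge> 0" "d > 0" "c * (r * opt m n - a) - ln (real n) \<ge> d" for c d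
  proof -
    have "0 \<le> a * (exp c - 1 - c)"
      using a exp_ge_add_one_self[of c] by (intro mult_nonneg_nonneg) linarith+
    then have "a * (exp c - 1 - c) / (c * (r * opt m n - a) - ln (real n)) \<le> a * (exp c - 1 - c) / d"
      using that by (intro divide_left_mono) auto
    then show ?thesis
      using max_load_tail[OF k that(1) n, of a S "r * opt m n"] that assms(6) by (simp add: a_def)
  qed
  show ?thesis
  proof (cases "real m \<le> 1 / 2 * real n * log 2 (real n)")
    case True
    define q where "q = ln (real n) / a"
    \<comment> \<open>Since \<open>ln 2\<close> exceeds 1/2, the sparse regime forces
      \<open>a\<close> strictly below \<open>ln n\<close>, hence \<open>q > 1\<close>.\<close>
    have "a \<le> real l / 2"
      using True assms(5) by (simp add: a_def log_n field_simps)
    moreover have "ln 2 > (1/2 :: real)"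
      using ln2_ge_two_thirds by simp
    then have "real l * ln 2 > real l * (1 / 2)"
      using l by (intro mult_strict_left_mono) auto
    ultimately have "a < ln (real n)" by (simp add: ln_n)
    then have q: "q > 1" using a by (simp add: q_def)
    have lq: "ln q > 0" "ln q < q" using q ln_less_self[of q] by auto
    have qm: "real n * ln (real n) / real m = q"
      by (simp add: q_def a_def)
    have "opt m n = log 2 (real n) / log 2 q"
      using True unfolding opt_def qm by simp
    then have opt: "opt m n = ln (real n) / ln q"
      by (simp add: log_def)
    have aq: "a = ln (real n) / q" using a ln_n0 by (simp add: q_def)
    \<comment> \<open>Chosen so that \<open>c * (r - 2) * opt m n\<close> equals
      \<open>2 * ln n\<close>: one \<open>ln n\<close> pays for the number of bins, the other
      remains as denominator.\<close>
    define c where "c = 2 * ln q / (r - 2)"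
    have c: "c > 0" using lq assms(7) by (simp add: c_def)
    \<comment> \<open>Follows from \<open>ln q < q\<close>, so subtracting the mean costs at most
      one multiple of \<open>opt m n\<close>.\<close>
    have "a \<le> opt m n"
      unfolding aq opt using lq q ln_n0 by (intro divide_left_mono mult_pos_pos) linarith+
    then have "(r - 2) * opt m n \<le> r * opt m n - a"
      using a by (simp add: algebra_simps)
    then have "c * ((r - 2) * opt m n) \<le> c * (r * opt m n - a)"
      using c by (intro mult_left_mono) auto
    moreover have "c * ((r - 2) * opt m n) = 2 * ln (real n)"
      using lq q assms(7) by (simp add: c_def opt)
    ultimately have "c * (r * opt m n - a) - ln (real n) \<ge> ln (real n)" by simp
    from tail[OF _ ln_n0 this] c have
      "measure_pmf.prob (pmf_of_set (surj_linear_maps :: (bit ^ 'u \<Rightarrow> bit ^ 'l) set))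
           {h. real (max_load S h) \<ge> r * opt m n} \<le> a * (exp c - 1 - c) / ln (real n)"
      by simp
    also have "\<dots> = (exp c - 1 - c) / q" using ln_n0 by (simp add: aq)
    also have "\<dots> \<le> 48 / (r - 2)\<^sup>2"
      unfolding c_def by (rule sparse_tail_exponent[OF q assms(7)])
    finally show ?thesis .
  next
    case False
    then have opt: "opt m n = a" by (simp add: opt_def a_def)
    have "real l / 2 < a"
      using False assms(5) by (simp add: a_def log_n field_simps)
    moreover have "real l * ln 2 \<le> real l * 1"
      using ln_2_less_1 by (intro mult_left_mono) auto
    ultimately have la: "ln (real n) \<le> 2 * a" by (simp add: ln_n)
    \<comment> \<open>Chosen so that \<open>c * (r - 2) * a\<close> equals \<open>3 * a\<close>: of
      this \<open>2 * a\<close> covers \<open>ln n\<close>, and \<open>a\<close> remains as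
      denominator.\<close>
    define c where "c = 3 / (r - 2)"
    have c: "c > 0" "c \<le> 1" using assms(7) by (auto simp: c_def)
    have "(r - 2) * a \<le> r * opt m n - a"
      using a by (simp add: opt algebra_simps)
    then have "c * ((r - 2) * a) \<le> c * (r * opt m n - a)"
      using c by (intro mult_left_mono) auto
    moreover have "c * ((r - 2) * a) = 3 * a"
      using assms(7) by (simp add: c_def)
    ultimately have "c * (r * opt m n - a) - ln (real n) \<ge> a" using la by simp
    from tail[OF _ a this] c have
      "measure_pmf.prob (pmf_of_set (surj_linear_maps :: (bit ^ 'u \<Rightarrow> bit ^ 'l) set))
           {h. real (max_load S h) \<ge> r * opt m n} \<le> a * (exp c - 1 - c) / a"
      by simp
    also have "\<dots> = exp c - 1 - c" using a by simp
    \<comment> \<open>The quadratic bound on the exponential requires \<open>c \<le> 1\<close>,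
      which \<open>r \<ge> 6\<close> ensures.\<close>
    also have "\<dots> \<le> c\<^sup>2" using exp_bound[of c] c by simp
    also have "\<dots> = 9 / (r - 2)\<^sup>2" by (simp add: c_def power_divide)
    also have "\<dots> \<le> 48 / (r - 2)\<^sup>2" by (intro divide_right_mono) auto
    finally show ?thesis .
  qed
qed

end
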